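(* Let $A$ be an invertible Mealy automaton over the binary alphabet $\{0,1\}$ and let $G=G(A)$ be the group generated by $A$. If $G$ is abelian, then $G$ is torsion free or $G$ is an elementary abelian 2-group.
   Context: A Mealy automaton over $X=\{0,1\}$ is a quadruple $A=(X,Q,\varphi,\psi)$, where $Q$ is a finite set (of states), $\varphi\colon Q\times X\to Q$ is the transition function and $\psi\colon Q\times X\to X$ is the output function. $A$ is invertible if for every $q\in Q$ the map $x\mapsto\psi(q,x)$ is a bijection of $X$. Let $X^*$ be the set of finite words over $X$ (including the empty word $\epsilon$), viewed as a rooted tree with root $\epsilon$ in which $w$ is adjacent to $wx$ for $w\in X^*$, $x\in X$. Each state $q\in Q$ defines a transformation $q\colon X^*\to X^*$ recursively by $q(\epsilon)=\epsilon$ and $q(xw)=\psi(q,x)\,q'(w)$, where $q'=\varphi(q,x)$, for $x\in X$, $w\in X^*$. If $A$ is invertible, each of these is an automorphism of the rooted tree $X^*$, and $G(A)$ is the subgroup of $Aut(X^* )$ generated by the transformations of all states $q\in Q$. A group is an elementary abelian 2-group if it is abelian and all its elements $g$ satisfy $g^2=id$ (the trivial group is allowed). *)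

theory Defs
  imports "HOL-Algebra.Algebra" "HOL-Library.Z2"
begin

definition tree_adj :: "'x list \<Rightarrow> 'x list \<Rightarrow> bool" where
  "tree_adj u v \<longleftrightarrow> (\<exists>x. v = u @ [x] \<or> u = v @ [x])"

definition tree_automorphism :: "('x list \<Rightarrow> 'x list) \<Rightarrow> bool" where
  "tree_automorphism f \<longleftrightarrow>
     bij f \<and> f [] = [] \<and> (\<forall>u v. tree_adj (f u) (f v) \<longleftrightarrow> tree_adj u v)"

definition tree_Aut :: "('x list \<Rightarrow> 'x list) monoid" where
  "tree_Aut = \<lparr>carrier = {f. tree_automorphism f}, monoid.mult = (\<circ>), one = id\<rparr>"

lemma tree_automorphism_inv:
  assumes "tree_automorphism f"
  shows "tree_automorphism (inv_into UNIV f)"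
proof -
  have b: "bij f" and e: "f [] = []" and a: "\<And>u v. tree_adj (f u) (f v) \<longleftrightarrow> tree_adj u v"
    using assms by (auto simp: tree_automorphism_def)
  have "tree_adj (inv_into UNIV f u) (inv_into UNIV f v) \<longleftrightarrow> tree_adj u v" for u v
    using a[of "inv_into UNIV f u" "inv_into UNIV f v"] b
    by (simp add: bij_is_surj surj_f_inv_f)
  moreover have "inv_into UNIV f [] = []"
    using b e by (metis bij_is_inj inv_f_f)
  ultimately show ?thesis
    using b by (simp add: tree_automorphism_def bij_imp_bij_inv)
qed

lemma group_tree_Aut: "group tree_Aut"
proof (rule groupI)
  fix f :: "'x list \<Rightarrow> 'x list"
  assume "f \<in> carrier tree_Aut"
  then have f: "tree_automorphism f" by (simp add: tree_Aut_def)
  then have "inv_into UNIV f \<circ> f = id"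
    by (simp add: tree_automorphism_def bij_is_inj)
  then show "\<exists>g\<in>carrier tree_Aut. g \<otimes>\<^bsub>tree_Aut\<^esub> f = \<one>\<^bsub>tree_Aut\<^esub>"
    using tree_automorphism_inv[OF f] by (auto simp: tree_Aut_def)
qed (auto simp: tree_Aut_def tree_automorphism_def bij_comp comp_assoc)

record 'q mealy =
  states :: "'q set"
  trans_fun :: "'q \<Rightarrow> bit \<Rightarrow> 'q"
  out_fun :: "'q \<Rightarrow> bit \<Rightarrow> bit"

definition mealy_automaton :: "'q mealy \<Rightarrow> bool" where
  "mealy_automaton A \<longleftrightarrow>
     finite (states A) \<and> (\<forall>q \<in> states A. \<forall>x. trans_fun A q x \<in> states A)"

definition invertible_mealy :: "'q mealy \<Rightarrow> bool" where
  "invertible_mealy A \<longleftrightarrow> (\<forall>q \<in> states A. bij (out_fun A q))"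

fun transformation :: "'q mealy \<Rightarrow> 'q \<Rightarrow> bit list \<Rightarrow> bit list" where
  "transformation A q [] = []"
| "transformation A q (x # w) = out_fun A q x # transformation A (trans_fun A q x) w"

definition mealy_group :: "'q mealy \<Rightarrow> (bit list \<Rightarrow> bit list) monoid" where
  "mealy_group A = subgroup_generated tree_Aut (transformation A ` states A)"

lemma length_transformation [simp]: "length (transformation A q w) = length w"
  by (induction w arbitrary: q) auto

lemma transformation_append:
  "transformation A q (u @ w) = transformation A q u @ transformation A (foldl (trans_fun A) q u) w"
  by (induction u arbitrary: q) auto

context
  fixes A :: "'q mealy"
  assumes aut: "mealy_automaton A" and invertible: "invertible_mealy A"
begin

lemma transformation_inject:
  "q \<in> states A \<Longrightarrow> transformation A q u = transformation A q v \<Longrightarrow> u = v"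
proof (induction u arbitrary: q v)
  case Nil
  then show ?case by (cases v) auto
next
  case (Cons x u)
  then obtain y v' where v: "v = y # v'" by (cases v) auto
  have "bij (out_fun A q)" using Cons.prems invertible by (simp add: invertible_mealy_def)
  then have "x = y" using Cons.prems v by (auto dest: bij_is_inj injD)
  moreover have "trans_fun A q x \<in> states A"
    using aut Cons.prems(1) by (simp add: mealy_automaton_def)
  ultimately show ?case using Cons v by auto
qed

lemma transformation_surj: "q \<in> states A \<Longrightarrow> \<exists>u. transformation A q u = w"
proof (induction w arbitrary: q)
  case Nil
  show ?case by (rule exI[of _ "[]"]) simp
next
  case (Cons y w)
  have "bij (out_fun A q)" using Cons.prems invertible by (simp add: invertible_mealy_def)
  then obtain x where x: "out_fun A q x = y" by (metis bij_pointE)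
  have "trans_fun A q x \<in> states A"
    using aut Cons.prems by (simp add: mealy_automaton_def)
  then obtain u where "transformation A (trans_fun A q x) u = w" using Cons.IH by blast
  then have "transformation A q (x # u) = y # w" using x by simp
  then show ?case by blast
qed

lemma tree_automorphism_transformation:
  assumes q: "q \<in> states A"
  shows "tree_automorphism (transformation A q)"
proof -
  let ?f = "transformation A q"
  have child: "(\<exists>y. ?f v = ?f u @ [y]) \<longleftrightarrow> (\<exists>x. v = u @ [x])" for u v
  proof
    assume "\<exists>y. ?f v = ?f u @ [y]"
    then obtain y where y: "?f v = ?f u @ [y]" by blast
    then have "length v = Suc (length u)"
      by (metis length_transformation length_append_singleton)
    then obtain v' x where v: "v = v' @ [x]" by (cases v rule: rev_cases) auto
    then have "?f v' = ?f u" using y by (simp add: transformation_append)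
    then show "\<exists>x. v = u @ [x]" using v transformation_inject[OF q] by blast
  qed (auto simp: transformation_append)
  have "tree_adj (?f u) (?f v) \<longleftrightarrow> tree_adj u v" for u v
    using child[of u v] child[of v u] unfolding tree_adj_def by blast
  moreover have "bij ?f"
    using transformation_inject[OF q] transformation_surj[OF q]
    unfolding bij_def inj_def surj_def by metis
  ultimately show ?thesis by (simp add: tree_automorphism_def)
qed

text \<open>\<^const>\<open>subgroup_generated\<close> intersects its generating set with the carrier of the ambient
  group; by the following lemma this discards nothing.\<close>

lemma carrier_mealy_group:
  "carrier (mealy_group A) = generate tree_Aut (transformation A ` states A)"
proof -
  have "transformation A ` states A \<subseteq> carrier tree_Aut"
    using tree_automorphism_transformation by (auto simp: tree_Aut_def)
  then show ?thesis
    by (simp add: mealy_group_def carrier_subgroup_generated Int_absorb1)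
qed

end

lemma group_mealy_group: "group (mealy_group A)"
  unfolding mealy_group_def by (rule group.group_subgroup_generated[OF group_tree_Aut])

definition torsion_free_group :: "('a, 'b) monoid_scheme \<Rightarrow> bool" where
  "torsion_free_group G \<longleftrightarrow> group G \<and>
     (\<forall>g \<in> carrier G. \<forall>n::nat. n > 0 \<longrightarrow> g [^]\<^bsub>G\<^esub> n = \<one>\<^bsub>G\<^esub> \<longrightarrow> g = \<one>\<^bsub>G\<^esub>)"

definition elementary_abelian_2_group :: "('a, 'b) monoid_scheme \<Rightarrow> bool" where
  "elementary_abelian_2_group G \<longleftrightarrow> comm_group G \<and>
     (\<forall>g \<in> carrier G. g [^]\<^bsub>G\<^esub> (2::nat) = \<one>\<^bsub>G\<^esub>)"

end

(* Every element of G acts at the root as x \<mapsto> x + s for some s in Z/2 and has its sections in G.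
   From a nontrivial torsion element one descends, through powers and sections, to an involution a
   that swaps the two subtrees of the root. Then every square in G is trivial: if g fixes the first
   level, the sections of g^2 are squares of sections of g; otherwise g^2 = (g a)^2, and g a fixes
   the first level. *)

theory Submission
  imports Defs
begin

text \<open>Both permutations of Z/2 are translations, and the value at 0 is the shift.\<close>

lemma bij_bit_add:
  fixes f :: "bit \<Rightarrow> bit"
  assumes "bij f"
  shows "f x = x + f 0"
proof (cases x)
  case one
  have "f 1 \<noteq> f 0" using assms by (auto dest: bij_is_inj injD)
  then show ?thesis using one by (cases "f 0"; cases "f 1") auto
qed simp

section \<open>Commuting tree maps closed under sections\<close>

text \<open>Isolates what the argument takes from the group. The shift \<open>s\<close> is common to
  both letters, whereas the section \<open>h\<close> may depend on \<open>x\<close>.\<close>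

locale self_similar_comm_monoid =
  fixes H :: "(bit list \<Rightarrow> bit list) set"
  assumes id_closed: "id \<in> H"
    and comp_closed: "f \<in> H \<Longrightarrow> g \<in> H \<Longrightarrow> f \<circ> g \<in> H"
    and comp_commute: "f \<in> H \<Longrightarrow> g \<in> H \<Longrightarrow> f \<circ> g = g \<circ> f"
    and Nil_fixed: "f \<in> H \<Longrightarrow> f [] = []"
    and sections: "f \<in> H \<Longrightarrow> \<exists>s. \<forall>x. \<exists>h\<in>H. \<forall>w. f (x # w) = (x + s) # h w"
begin

lemma funpow_closed: "f \<in> H \<Longrightarrow> f ^^ n \<in> H"
  by (induction n) (auto simp: id_closed comp_closed)

lemma funpow_section:
  assumes "\<And>w. f (x # w) = x # h w"
  shows "(f ^^ n) (x # w) = x # (h ^^ n) w"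
  by (induction n) (auto simp: assms)

definition active :: "(bit list \<Rightarrow> bit list) \<Rightarrow> bool" where
  "active f \<longleftrightarrow> (\<forall>x. \<exists>h\<in>H. \<forall>w. f (x # w) = (x + 1) # h w)"

lemma inactive_sections:
  assumes "f \<in> H" "\<not> active f"
  obtains h where "h \<in> H" "\<And>w. f (x # w) = x # h w"
proof -
  obtain s where s: "\<forall>x. \<exists>h\<in>H. \<forall>w. f (x # w) = (x + s) # h w"
    using sections[OF assms(1)] by blast
  then have "s = 0" using assms(2) unfolding active_def by (cases s) auto
  then have "\<exists>h\<in>H. \<forall>w. f (x # w) = x # h w" using spec[OF s, of x] by (simp only: add_0_right)
  then show ?thesis using that by blast
qed

lemma active_comp_active:
  assumes "active f" "active g"
  shows "\<not> active (f \<circ> g)"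
proof
  assume "active (f \<circ> g)"
  then obtain h where "\<And>w. (f \<circ> g) (0 # w) = (0 + 1) # h w"
    unfolding active_def by blast
  moreover obtain k where "\<And>w. g (0 # w) = (0 + 1) # k w"
    using assms(2) unfolding active_def by blast
  moreover obtain l where "\<And>w. f (1 # w) = (1 + 1) # l w"
    using assms(1) unfolding active_def by blast
  ultimately show False by simp
qed

text \<open>Each application of \<open>f\<close> adds 1 to the first letter, so
  \<open>f ^^ m\<close> sends 0 to \<open>m\<close> modulo 2 at the root.\<close>

lemma active_funpow_id_even:
  assumes "active f" "f ^^ n = id"
  shows "even n"
proof -
  have head: "\<exists>w. (f ^^ m) [0] = of_nat m # w" for m
  proof (induction m)
    case (Suc m)
    then show ?case using assms(1) unfolding active_def
      by (metis add.commute comp_apply funpow.simps(2) of_nat_Suc)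
  qed simp
  have "of_nat n = (0::bit)" using head[of n] assms(2) by simp
  moreover have "of_nat m = (0::bit) \<longleftrightarrow> even m" for m
    by (induction m) simp_all
  ultimately show ?thesis by simp
qed

text \<open>Descends along a moved word: if \<open>f\<close> is inactive, its section at the first
  letter has the same exponent and moves the tail. The descent stops at an active map, since the
  empty word is never moved.\<close>

lemma ex_active_funpow_id:
  assumes "f \<in> H" "f ^^ n = id" "f w \<noteq> w"
  shows "\<exists>a\<in>H. active a \<and> a ^^ n = id"
  using assms
proof (induction w arbitrary: f)
  case Nil
  then show ?case by (simp add: Nil_fixed)
next
  case (Cons x w)
  show ?case
  proof (cases "active f")
    case False
    then obtain h where h: "h \<in> H" "\<And>w. f (x # w) = x # h w"
      using inactive_sections Cons.prems(1) by blast
    have "x # (h ^^ n) v = x # v" for v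
      using funpow_section[of f x h n v] h(2) Cons.prems(2) by simp
    then have "h ^^ n = id" by auto
    moreover have "h w \<noteq> w" using h(2) Cons.prems(3) by auto
    ultimately show ?thesis using Cons.IH h(1) by blast
  qed (use Cons.prems in blast)
qed

text \<open>Halves the even exponent of an active element \<open>a\<close> until the power
  \<open>a ^^ m\<close> is a nontrivial involution.\<close>

lemma ex_active_involution:
  assumes "f \<in> H" "f \<noteq> id" "f ^^ n = id" "n > 0"
  shows "\<exists>a\<in>H. active a \<and> a \<circ> a = id"
  using assms
proof (induction n arbitrary: f rule: less_induct)
  case (less n)
  obtain w where "f w \<noteq> w" using less.prems(2) by (auto simp: fun_eq_iff)
  then obtain a where a: "a \<in> H" "active a" "a ^^ n = id"
    using ex_active_funpow_id less.prems by blast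
  then obtain m where m: "n = m * 2" using active_funpow_id_even by (metis dvdE mult.commute)
  show ?case
  proof (cases "a ^^ m = id")
    case True
    have "a [0] \<noteq> [0]" using a(2) unfolding active_def
      by (metis add_0_left list.inject zero_neq_one)
    then have "a \<noteq> id" by auto
    moreover have "m < n" "m > 0" using m less.prems(4) by simp_all
    ultimately show ?thesis using less.IH[OF _ a(1) _ True] by blast
  next
    case False
    then obtain v where v: "(a ^^ m) v \<noteq> v" by (auto simp: fun_eq_iff)
    have "(a ^^ m) ^^ 2 = id" using a(3) m by (simp add: funpow_mult mult.commute)
    \<comment> \<open>The involution \<open>a ^^ m\<close> may itself be inactive, so a second
      descent, now with exponent 2, is made.\<close>
    then have "\<exists>b\<in>H. active b \<and> b ^^ 2 = id"
      using ex_active_funpow_id[OF funpow_closed[OF a(1)] _ v] by blast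
    then show ?thesis unfolding numeral_2_eq_2 funpow.simps comp_id .
  qed
qed

lemma square_id:
  assumes a: "a \<in> H" "active a" "a \<circ> a = id" and "f \<in> H"
  shows "f (f w) = w"
  using assms(4)
proof (induction w arbitrary: f)
  case Nil
  then show ?case by (simp add: Nil_fixed)
next
  case (Cons x w)
  \<comment> \<open>Here \<open>g (g (x # w))\<close> is \<open>x # h (h w)\<close> for a section
    \<open>h\<close>, to which the induction hypothesis applies. A general \<open>g\<close> is taken
    because both \<open>f\<close> and \<open>f \<circ> a\<close> are needed.\<close>
  have inactive: "g (g (x # w)) = x # w" if "g \<in> H" "\<not> active g" for g
    using inactive_sections[OF that] Cons.IH by metis
  show ?case
  proof (cases "active f")
    case True
    have "(f \<circ> a) \<circ> (f \<circ> a) = f \<circ> (a \<circ> f) \<circ> a" by (simp add: comp_assoc)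
    \<comment> \<open>Commutativity enters here.\<close>
    also have "\<dots> = f \<circ> f \<circ> (a \<circ> a)"
      using comp_commute[OF a(1) Cons.prems] by (simp add: comp_assoc)
    finally have "(f \<circ> a) ((f \<circ> a) (x # w)) = f (f (x # w))"
      using a(3) by (metis comp_apply id_apply)
    then show ?thesis
      using inactive[of "f \<circ> a"] active_comp_active[OF True a(2)] comp_closed Cons.prems a(1)
      by simp
  qed (use inactive Cons.prems in blast)
qed

end

section \<open>Sections in the group of an automaton\<close>

context
  fixes A :: "'q mealy"
  assumes aut: "mealy_automaton A" and invertible: "invertible_mealy A"
begin

lemma transformation_sections:
  assumes "q \<in> states A"
  shows "transformation A q (x # w)
    = (x + out_fun A q 0) # transformation A (trans_fun A q x) w"
  using bij_bit_add[of "out_fun A q" x] assms invertible by (simp add: invertible_mealy_def)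

lemma transformation_inv:
  assumes q: "q \<in> states A"
  shows "transformation A q ((inv\<^bsub>tree_Aut\<^esub> (transformation A q)) w) = w"
proof -
  have "transformation A q \<in> carrier tree_Aut"
    using tree_automorphism_transformation[OF aut invertible q] by (simp add: tree_Aut_def)
  then have "transformation A q \<otimes>\<^bsub>tree_Aut\<^esub> inv\<^bsub>tree_Aut\<^esub> (transformation A q) = \<one>\<^bsub>tree_Aut\<^esub>"
    by (rule group.r_inv[OF group_tree_Aut])
  then show ?thesis by (simp add: tree_Aut_def fun_eq_iff)
qed

text \<open>The letter \<open>y\<close> is the one that \<open>q\<close> sends to \<open>x\<close>,
  so the section of the inverse at \<open>x\<close> is the inverse of the section of
  \<open>q\<close> at \<open>y\<close>. Both sides are compared after applying the injective map of
  \<open>q\<close>.\<close>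

lemma inv_transformation_sections:
  assumes q: "q \<in> states A" and y: "y = x + out_fun A q 0"
  shows "(inv\<^bsub>tree_Aut\<^esub> (transformation A q)) (x # w)
    = y # (inv\<^bsub>tree_Aut\<^esub> (transformation A (trans_fun A q y))) w" (is "?l = ?r")
proof (rule transformation_inject[OF aut invertible q])
  have "trans_fun A q y \<in> states A" using aut q by (simp add: mealy_automaton_def)
  then have "transformation A q ?r = (y + out_fun A q 0) # w"
    by (simp add: transformation_sections[OF q] transformation_inv del: transformation.simps)
  \<comment> \<open>The shift is added twice and cancels in Z/2.\<close>
  moreover have "y + out_fun A q 0 = x" by (cases x; cases "out_fun A q 0") (simp_all add: y)
  ultimately show "transformation A q ?l = transformation A q ?r"
    using transformation_inv[OF q] by metis
qed

lemma mealy_group_sections: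
  assumes "f \<in> carrier (mealy_group A)"
  shows "\<exists>s. \<forall>x. \<exists>h\<in>carrier (mealy_group A). \<forall>w. f (x # w) = (x + s) # h w"
  using assms unfolding carrier_mealy_group[OF aut invertible]
proof (induction rule: generate.induct)
  case one
  show ?case
    by (rule exI[of _ 0]) (auto simp: tree_Aut_def intro!: bexI[OF _ generate.one])
next
  case (incl f)
  then obtain q where q: "q \<in> states A" "f = transformation A q" by blast
  then have "trans_fun A q x \<in> states A" for x using aut by (simp add: mealy_automaton_def)
  then show ?case
    using transformation_sections[OF q(1)] q(2) by (metis generate.incl imageI)
next
  case (inv f)
  then obtain q where q: "q \<in> states A" "f = transformation A q" by blast
  then have "trans_fun A q x \<in> states A" for x using aut by (simp add: mealy_automaton_def)
  then show ?case
    using inv_transformation_sections[OF q(1) refl] q(2) by (metis generate.inv imageI)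
next
  case (eng f g)
  then obtain s t where
    s: "\<And>x. \<exists>h\<in>generate tree_Aut (transformation A ` states A). \<forall>w. f (x # w) = (x + s) # h w" and
    t: "\<And>x. \<exists>h\<in>generate tree_Aut (transformation A ` states A). \<forall>w. g (x # w) = (x + t) # h w"
    by blast
  show ?case
  proof (intro exI[of _ "t + s"] allI)
    fix x
    obtain k where k: "k \<in> generate tree_Aut (transformation A ` states A)"
      "\<And>w. g (x # w) = (x + t) # k w" using t by blast
    \<comment> \<open>As \<open>g\<close> acts first, the section of \<open>f\<close> is taken at
      the image \<open>x + t\<close> of the letter.\<close>
    obtain h where h: "h \<in> generate tree_Aut (transformation A ` states A)"
      "\<And>w. f ((x + t) # w) = (x + t + s) # h w" using s by blast
    show "\<exists>h\<in>generate tree_Aut (transformation A ` states A).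
        \<forall>w. (f \<otimes>\<^bsub>tree_Aut\<^esub> g) (x # w) = (x + (t + s)) # h w"
      by (rule bexI[OF _ generate.eng[OF h(1) k(1)]])
        (simp only: tree_Aut_def monoid.simps comp_apply h(2) k(2) add.assoc simp_thms)
  qed
qed

end

section \<open>Group operations as composition, and the dichotomy\<close>

lemma mult_mealy_group: "f \<otimes>\<^bsub>mealy_group A\<^esub> g = f \<circ> g"
  by (simp add: mealy_group_def tree_Aut_def)

lemma one_mealy_group: "\<one>\<^bsub>mealy_group A\<^esub> = id"
  by (simp add: mealy_group_def tree_Aut_def)

text \<open>Group powers add factors on the right and \<open>funpow\<close> on the left, hence
  \<open>funpow_Suc_right\<close>.\<close>

lemma pow_mealy_group: "f [^]\<^bsub>mealy_group A\<^esub> (n::nat) = f ^^ n"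
  by (induction n)
    (simp_all add: mult_mealy_group one_mealy_group nat_pow_def funpow_Suc_right del: funpow.simps(2))

theorem proposition8:
  fixes A :: "'q mealy"
  assumes "mealy_automaton A"
    and "invertible_mealy A"
    and "comm_group (mealy_group A)"
  shows "torsion_free_group (mealy_group A) \<or> elementary_abelian_2_group (mealy_group A)"
proof -
  interpret G: comm_group "mealy_group A" by fact
  interpret self_similar_comm_monoid "carrier (mealy_group A)"
  proof
    fix f assume f: "f \<in> carrier (mealy_group A)"
    then have "f \<in> carrier tree_Aut"
      using group.carrier_subgroup_generated_subset[OF group_tree_Aut]
      unfolding mealy_group_def by blast
    then show "f [] = []" by (simp add: tree_Aut_def tree_automorphism_def)
  qed (use G.one_closed G.m_closed G.m_comm mealy_group_sections[OF assms(1,2)] in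
      \<open>simp_all add: mult_mealy_group one_mealy_group\<close>)
  show ?thesis
  proof (cases "torsion_free_group (mealy_group A)")
    case False
    \<comment> \<open>Being a group is part of \<open>torsion_free_group\<close>; with
      \<open>group_mealy_group\<close>, its failure must come from a torsion element.\<close>
    then obtain g and n :: nat where "g \<in> carrier (mealy_group A)" "n > 0" "g ^^ n = id" "g \<noteq> id"
      unfolding torsion_free_group_def pow_mealy_group one_mealy_group
      using group_mealy_group by blast
    then obtain a where "a \<in> carrier (mealy_group A)" "active a" "a \<circ> a = id"
      using ex_active_involution by blast
    then have "f \<circ> f = id" if "f \<in> carrier (mealy_group A)" for f
      using square_id that by (auto simp: fun_eq_iff)
    then show ?thesis
      using assms(3)
      unfolding elementary_abelian_2_group_def pow_mealy_group one_mealy_group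
      by (simp add: numeral_2_eq_2)
  qed simp
qed

end
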